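(* Let $u\ge 1$ and $r>u$ be integers and let $F$ be a fixed $u$-uniform hypergraph with at least one hyperedge. Then $osat_r(n,\text{Berge-}F)=O(n^{u-1})$ as $n\to\infty$ (the implied constant may depend on $F$ and $r$). Moreover, for every $n$ there is an $r$-uniform hypergraph $H$ on $n$ vertices with $O(n^{u-1})$ hyperedges such that for every $r$-subset $h$ of $V(H)$ that is not a hyperedge of $H$, adding $h$ to $H$ creates a Berge-$F$ (consisting of $h$ and $|E(F)|-1$ hyperedges of $H$) having a core hypergraph $F_0$ (a copy of $F$) such that $F_0$ is not a core hypergraph of any Berge-$F$ contained in $H$.
   Context: A hypergraph $H'$ is a Berge copy of a hypergraph $F$ (in short, $H'$ is a Berge-$F$) if $V(F)\subset V(H')$ and there is a bijection $f:E(F)\to E(H')$ such that $e\subset f(e)$ for every $e\in E(F)$. (Here $F$ is identified with a copy of it on vertices of $H'$.) This copy of $F$ is then called a core hypergraph of $H'$; a Berge-$F$ may have several core hypergraphs. An $r$-uniform hypergraph $H$ is Berge-$F$-oversaturated if for every $r$-subset $h\subset V(H)$ that is not a hyperedge of $H$ there is a Berge-$F$ that consists of $h$ and $|E(F)|-1$ hyperedges of $H$. $osat_r(n,\text{Berge-}F)$ denotes the smallest number of hyperedges in a Berge-$F$-oversaturated $r$-uniform hypergraph on $n$ vertices. *)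

theory Defs
  imports Complex_Main "HOL-Library.Landau_Symbols"
begin

record 'a hypergraph =
  verts :: "'a set"
  hyperedges :: "'a set set"

definition wf_hypergraph :: "'a hypergraph \<Rightarrow> bool" where
  "wf_hypergraph H \<longleftrightarrow> finite (verts H) \<and> (\<forall>e\<in>hyperedges H. e \<subseteq> verts H)"

definition uniform_hypergraph :: "nat \<Rightarrow> 'a hypergraph \<Rightarrow> bool" where
  "uniform_hypergraph r H \<longleftrightarrow> wf_hypergraph H \<and> (\<forall>e\<in>hyperedges H. card e = r)"

definition subhypergraph :: "'a hypergraph \<Rightarrow> 'a hypergraph \<Rightarrow> bool" where
  "subhypergraph H' H \<longleftrightarrow>
     wf_hypergraph H' \<and> verts H' \<subseteq> verts H \<and> hyperedges H' \<subseteq> hyperedges H"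

definition is_copy :: "'a hypergraph \<Rightarrow> 'b hypergraph \<Rightarrow> bool" where
  "is_copy F F0 \<longleftrightarrow>
     (\<exists>\<phi>. bij_betw \<phi> (verts F) (verts F0) \<and> hyperedges F0 = (\<lambda>e. \<phi> ` e) ` hyperedges F)"

definition is_core :: "'a hypergraph \<Rightarrow> 'b hypergraph \<Rightarrow> 'b hypergraph \<Rightarrow> bool" where
  "is_core F F0 H' \<longleftrightarrow>
     is_copy F F0 \<and> verts F0 \<subseteq> verts H' \<and>
     (\<exists>f. bij_betw f (hyperedges F0) (hyperedges H') \<and> (\<forall>e\<in>hyperedges F0. e \<subseteq> f e))"

definition is_berge :: "'a hypergraph \<Rightarrow> 'b hypergraph \<Rightarrow> bool" where
  "is_berge F H' \<longleftrightarrow> (\<exists>F0. is_core F F0 H')"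

text \<open>\<open>H'\<close> is a Berge copy of \<open>F\<close> on vertices of \<open>H\<close> whose hyperedges are \<open>h\<close> and
  \<open>|E(F)| - 1\<close> hyperedges of \<open>H\<close>. Its vertex set may contain vertices of \<open>H\<close> lying in none of its
  hyperedges; these are needed when \<open>F\<close> has isolated vertices.\<close>

definition berge_through ::
  "'a hypergraph \<Rightarrow> 'b hypergraph \<Rightarrow> 'b set \<Rightarrow> 'b hypergraph \<Rightarrow> bool" where
  "berge_through F H h H' \<longleftrightarrow>
     wf_hypergraph H' \<and> verts H' \<subseteq> verts H \<and>
     (\<exists>E\<subseteq>hyperedges H. card E = card (hyperedges F) - 1 \<and> hyperedges H' = insert h E) \<and>
     is_berge F H'"

definition berge_oversaturated :: "nat \<Rightarrow> 'a hypergraph \<Rightarrow> 'b hypergraph \<Rightarrow> bool" where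
  "berge_oversaturated r F H \<longleftrightarrow>
     uniform_hypergraph r H \<and>
     (\<forall>h. h \<subseteq> verts H \<and> card h = r \<and> h \<notin> hyperedges H \<longrightarrow> (\<exists>H'. berge_through F H h H'))"

text \<open>Up to isomorphism, every hypergraph on \<open>n\<close> vertices has its vertices in \<open>nat\<close>.\<close>

definition osat :: "nat \<Rightarrow> nat \<Rightarrow> 'a hypergraph \<Rightarrow> nat" where
  "osat r n F =
     (LEAST m. \<exists>H :: nat hypergraph.
        card (verts H) = n \<and> berge_oversaturated r F H \<and> card (hyperedges H) = m)"

text \<open>The complete hypergraph is vacuously oversaturated, so the minimum exists for all
  \<open>r\<close>, \<open>n\<close> and \<open>F\<close>.\<close>

lemma osat_attained:
  "\<exists>H :: nat hypergraph.
     card (verts H) = n \<and> berge_oversaturated r F H \<and> card (hyperedges H) = osat r n F"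
proof -
  define K :: "nat hypergraph" where
    "K = \<lparr>verts = {..<n}, hyperedges = {e. e \<subseteq> {..<n} \<and> card e = r}\<rparr>"
  have "card (verts K) = n \<and> berge_oversaturated r F K \<and> card (hyperedges K) = card (hyperedges K)"
    by (auto simp: K_def berge_oversaturated_def uniform_hypergraph_def wf_hypergraph_def)
  then have "\<exists>m. \<exists>H :: nat hypergraph.
      card (verts H) = n \<and> berge_oversaturated r F H \<and> card (hyperedges H) = m"
    by blast
  from LeastI_ex[OF this] show ?thesis
    unfolding osat_def .
qed

end

theory Submission
  imports Defs
begin

text \<open>
  Fix a vertex set \<open>S\<close> of constant size and let \<open>H\<close> consist of all \<open>r\<close>-sets with fewer than \<open>u\<close>
  vertices outside \<open>S\<close>; there are \<open>O(n\<^sup>u\<^sup>-\<^sup>1)\<close> of them. A missing \<open>r\<close>-set \<open>h\<close> contains a \<open>u\<close>-set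
  \<open>e\<close> outside \<open>S\<close>, and no hyperedge of \<open>H\<close> contains \<open>e\<close>. Place a copy \<open>F\<^sub>0\<close> of \<open>F\<close> so that one
  edge is \<open>e\<close> and all other vertices lie in \<open>S\<close>. The edge \<open>e\<close> is enlarged to \<open>h\<close>, and every other
  edge meets the outside of \<open>S\<close> in fewer than \<open>u\<close> vertices, hence becomes a hyperedge of \<open>H\<close>
  after adding \<open>r - u\<close> further vertices of \<open>S\<close>. Adding the same vertices, disjoint from \<open>F\<^sub>0\<close>, to
  all of these edges keeps them distinct.
\<close>

text \<open>\<open>S\<close> need not lie inside \<open>V\<close>: if \<open>V\<close> is contained
  in \<open>S\<close> and \<open>u\<close> is positive, this is the complete
  \<open>r\<close>-uniform hypergraph, which settles small \<open>n\<close>.\<close>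

definition near_hypergraph :: "nat \<Rightarrow> nat \<Rightarrow> 'b set \<Rightarrow> 'b set \<Rightarrow> 'b hypergraph" where
  "near_hypergraph u r S V =
     \<lparr>verts = V, hyperedges = {h. h \<subseteq> V \<and> card h = r \<and> card (h - S) < u}\<rparr>"

lemma verts_near_hypergraph [simp]: "verts (near_hypergraph u r S V) = V"
  by (simp add: near_hypergraph_def)

lemma hyperedges_near_hypergraph [simp]:
  "hyperedges (near_hypergraph u r S V) = {h. h \<subseteq> V \<and> card h = r \<and> card (h - S) < u}"
  by (simp add: near_hypergraph_def)

lemma uniform_near_hypergraph:
  "finite V \<Longrightarrow> uniform_hypergraph r (near_hypergraph u r S V)"
  by (auto simp: uniform_hypergraph_def wf_hypergraph_def)

section \<open>Counting the hyperedges\<close>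

lemma card_small_subsets_le:
  assumes "finite V" "V \<noteq> {}"
  shows "card {T. T \<subseteq> V \<and> card T < u} \<le> u * card V ^ (u - 1)"
proof -
  have "{T. T \<subseteq> V \<and> card T < u} = (\<Union>j<u. {T. T \<subseteq> V \<and> card T = j})"
    by auto
  then have "card {T. T \<subseteq> V \<and> card T < u} \<le> (\<Sum>j<u. card {T. T \<subseteq> V \<and> card T = j})"
    using card_UN_le[of "{..<u}" "\<lambda>j. {T. T \<subseteq> V \<and> card T = j}"] by simp
  also have "\<dots> = (\<Sum>j<u. card V choose j)"
    using assms by (simp add: n_subsets)
  also have "\<dots> \<le> (\<Sum>j<u. card V ^ (u - 1))"
  proof (rule sum_mono)
    fix j assume "j \<in> {..<u}"
    \<comment> \<open>Powers of \<open>card V\<close> increase with the exponent only for a positive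
      base; for empty \<open>V\<close> and \<open>u\<close> at least 2 the lemma would fail, as the
      empty set is counted.\<close>
    moreover have "card V > 0"
      using assms by (simp add: card_gt_0_iff)
    ultimately have "card V ^ j \<le> card V ^ (u - 1)"
      by (intro power_increasing) auto
    moreover have "card V choose j \<le> card V ^ j"
      by (cases "j \<le> card V") (auto simp: binomial_le_pow binomial_eq_0)
    ultimately show "card V choose j \<le> card V ^ (u - 1)"
      by linarith
  qed
  finally show ?thesis by simp
qed

text \<open>A hyperedge \<open>h\<close> is determined by its trace on \<open>S\<close>, one of
  \<open>2 ^ card S\<close> sets, and by \<open>h - S\<close>, a set of fewer than \<open>u\<close>
  vertices.\<close>

lemma card_near_hypergraph_le:
  assumes "finite V" "finite S" "r > 0"
  shows "card (hyperedges (near_hypergraph u r S V)) \<le> 2 ^ card S * u * card V ^ (u - 1)"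
proof (cases "V = {}")
  case True
  then have "hyperedges (near_hypergraph u r S V) = {}"
    using \<open>r > 0\<close> by auto
  then show ?thesis by (simp only: card.empty zero_le)
next
  case False
  let ?E = "hyperedges (near_hypergraph u r S V)"
  let ?B = "Pow S \<times> {T. T \<subseteq> V \<and> card T < u}"
  have "inj_on (\<lambda>h. (h \<inter> S, h - S)) ?E"
    by (rule inj_onI) blast
  moreover have "(\<lambda>h. (h \<inter> S, h - S)) ` ?E \<subseteq> ?B"
    by auto
  moreover have "finite ?B"
    using assms by auto
  ultimately have "card ?E \<le> card ?B"
    by (rule card_inj_on_le)
  also have "\<dots> = 2 ^ card S * card {T. T \<subseteq> V \<and> card T < u}"
    using assms by (simp add: card_cartesian_product card_Pow)
  also have "\<dots> \<le> 2 ^ card S * (u * card V ^ (u - 1))"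
    using card_small_subsets_le[OF \<open>finite V\<close> False] by simp
  finally show ?thesis by (simp add: mult.assoc)
qed

section \<open>Berge copies through a missing set\<close>

text \<open>A bijection from \<open>e0\<close> to \<open>e\<close> and an injection of the other
  vertices into \<open>S\<close> glue to an injection, because \<open>e\<close> and \<open>S\<close>
  are disjoint.\<close>

lemma inj_on_extending_edge:
  assumes "finite W" "e0 \<subseteq> W" "finite e" "card e0 = card e" "finite S" "card W \<le> card S"
    and "e \<inter> S = {}"
  obtains \<phi> where "inj_on \<phi> W" "\<phi> ` e0 = e" "\<phi> ` (W - e0) \<subseteq> S"
proof -
  have "finite e0"
    using assms finite_subset by blast
  then obtain f where f: "bij_betw f e0 e"
    using assms finite_same_card_bij by metis
  have "card (W - e0) \<le> card S"
    using \<open>card W \<le> card S\<close> \<open>finite W\<close> by (meson Diff_subset card_mono order_trans)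
  then obtain g where g: "g ` (W - e0) \<subseteq> S" "inj_on g (W - e0)"
    using assms card_le_inj[of "W - e0" S] by auto
  define \<phi> where "\<phi> x = (if x \<in> e0 then f x else g x)" for x
  have img: "\<phi> ` e0 = e" "\<phi> ` (W - e0) \<subseteq> S"
    using f g by (auto simp: \<phi>_def bij_betw_def)
  have "inj_on \<phi> e0" "inj_on \<phi> (W - e0)"
    using f g by (auto simp: \<phi>_def bij_betw_def inj_on_def)
  then have "inj_on \<phi> (e0 \<union> (W - e0))"
    using img \<open>e \<inter> S = {}\<close> by (subst inj_on_Un) blast
  then have "inj_on \<phi> W"
    using \<open>e0 \<subseteq> W\<close> by (simp add: Un_absorb1)
  with img show ?thesis by (rule that[rotated])
qed

lemma near_hypergraph_berge:
  assumes F: "uniform_hypergraph u F" "hyperedges F \<noteq> {}"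
    and "r \<ge> u" "finite V" "S \<subseteq> V" "card S \<ge> card (verts F) + r"
    and h: "h \<subseteq> V" "card h = r" "card (h - S) \<ge> u"
  shows "\<exists>H' F0. berge_through F (near_hypergraph u r S V) h H' \<and> is_core F F0 H' \<and>
    \<not> (\<exists>H''. subhypergraph H'' (near_hypergraph u r S V) \<and> is_core F F0 H'')"
proof -
  let ?H = "near_hypergraph u r S V"
  let ?E = "hyperedges F"
  have finW: "finite (verts F)" and E: "\<And>x. x \<in> ?E \<Longrightarrow> x \<subseteq> verts F \<and> card x = u"
    using F by (auto simp: uniform_hypergraph_def wf_hypergraph_def)
  have finE: "finite ?E"
    using finW E by (meson Pow_iff finite_Pow_iff finite_subset subsetI)
  have finS: "finite S" and finh: "finite h"
    using assms finite_subset by blast+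
  obtain e0 where e0: "e0 \<in> ?E"
    using F by blast
  obtain e where e: "e \<subseteq> h - S" "card e = u"
    using h by (meson obtain_subset_with_card_n)
  have fine: "finite e"
    using e finh by (meson finite_Diff finite_subset)
  obtain \<phi> where \<phi>: "inj_on \<phi> (verts F)" "\<phi> ` e0 = e" "\<phi> ` (verts F - e0) \<subseteq> S"
    by (rule inj_on_extending_edge[of "verts F" e0 e S])
      (use finW E[OF e0] fine e finS \<open>card S \<ge> card (verts F) + r\<close> in auto)
  define W where "W = \<phi> ` verts F"
  have finWi: "finite W" and cardW: "card W = card (verts F)"
    using finW \<phi> by (auto simp: W_def card_image)
  \<comment> \<open>\<open>S\<close> was chosen large enough to hold both the image of
    \<open>F\<close> and a padding set \<open>A\<close> that avoids this image.\<close>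
  have "card (S - W) \<ge> card S - card W"
    using finWi by (rule diff_card_le_card_Diff)
  then have "r - u \<le> card (S - W)"
    using cardW \<open>card S \<ge> card (verts F) + r\<close> by linarith
  then obtain A where A: "A \<subseteq> S - W" "card A = r - u"
    by (meson obtain_subset_with_card_n)
  have finA: "finite A"
    using A finS by (meson finite_Diff finite_subset)
  have "W \<subseteq> \<phi> ` e0 \<union> \<phi> ` (verts F - e0)"
    by (auto simp: W_def)
  then have "W \<subseteq> e \<union> S"
    unfolding \<phi>(2) using \<phi>(3) by (meson Un_mono order_refl subset_trans)
  then have WV: "W \<subseteq> V"
    using e(1) h(1) \<open>S \<subseteq> V\<close> by auto
  define F0 where "F0 = \<lparr>verts = W, hyperedges = (\<lambda>x. \<phi> ` x) ` ?E\<rparr>"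
  define f where "f x = (if x = e then h else x \<union> A)" for x
  \<comment> \<open>Taking all of \<open>V\<close> as vertex set leaves room for the images of
    isolated vertices of \<open>F\<close>.\<close>
  define H' where "H' = \<lparr>verts = V, hyperedges = f ` hyperedges F0\<rparr>"
  have E0: "hyperedges F0 = (\<lambda>x. \<phi> ` x) ` ?E"
    by (simp add: F0_def)
  have sub: "x \<subseteq> W" if "x \<in> hyperedges F0" for x
    using that E by (auto simp: E0 W_def)
  have e_in: "e \<in> hyperedges F0"
    using e0 \<phi> by (auto simp: E0)
  have injE: "inj_on (\<lambda>x. \<phi> ` x) ?E"
    using \<phi>(1) E by (meson Pow_iff inj_on_image_Pow inj_on_subset subsetI)
  have fin0: "finite (hyperedges F0)" and card0: "card (hyperedges F0) = card ?E"
    using finE injE by (auto simp: E0 card_image)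
  have near: "x \<union> A \<in> hyperedges ?H" if x: "x \<in> hyperedges F0" "x \<noteq> e" for x
  proof -
    obtain y where y: "y \<in> ?E" "x = \<phi> ` y"
      using x by (auto simp: E0)
    have cx: "card x = u"
      using y E \<phi>(1) by (metis card_image inj_on_subset)
    have finx: "finite x"
      using sub[OF x(1)] finWi finite_subset by blast
    \<comment> \<open>Vertices of \<open>F\<close> not in \<open>e0\<close> are sent into
      \<open>S\<close>, so what sticks out of \<open>S\<close> lies in \<open>e\<close>. Equality
      would force \<open>x = e\<close>, since both have \<open>u\<close> elements; hence fewer than
      \<open>u\<close> vertices stick out.\<close>
    have "x - S \<subseteq> e"
      using y E[OF y(1)] \<phi>(2,3) by blast
    then have "x \<union> A - S \<subseteq> e"
      using A by blast
    moreover have "x \<union> A - S \<noteq> e"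
    proof
      assume "x \<union> A - S = e"
      then have "e \<subseteq> x"
        using A by blast
      then have "e = x"
        using cx e(2) finx by (simp add: card_subset_eq)
      with x(2) show False by simp
    qed
    ultimately have "card (x \<union> A - S) < u"
      using fine e(2) by (metis psubsetI psubset_card_mono)
    moreover have "card (x \<union> A) = r"
      using A cx finx finA sub[OF x(1)] \<open>r \<ge> u\<close> by (subst card_Un_disjoint) auto
    moreover have "x \<union> A \<subseteq> V"
      using sub[OF x(1)] WV A \<open>S \<subseteq> V\<close> by blast
    ultimately show ?thesis by simp
  qed
  have h_notin: "h \<notin> hyperedges ?H"
    using h by simp
  have injf: "inj_on f (hyperedges F0)"
  proof (rule inj_onI)
    fix x y assume xy: "x \<in> hyperedges F0" "y \<in> hyperedges F0" and eq: "f x = f y"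
    show "x = y"
    \<comment> \<open>If only one of the two is \<open>e\<close>, then \<open>h\<close> would equal
      a hyperedge of the original hypergraph. If neither is, removing \<open>A\<close>, which is
      disjoint from \<open>W\<close>, recovers \<open>x\<close> and \<open>y\<close>.\<close>
    proof (cases "x = e \<or> y = e")
      case True
      then show ?thesis
        using xy eq near h_notin by (auto simp: f_def split: if_splits)
    next
      case False
      then have "x \<union> A = y \<union> A"
        using eq by (simp add: f_def)
      then show ?thesis
        using sub[OF xy(1)] sub[OF xy(2)] A by blast
    qed
  qed
  define E' where "E' = f ` (hyperedges F0 - {e})"
  have core: "is_core F F0 H'"
    unfolding is_core_def
  proof (intro conjI exI)
    have "bij_betw \<phi> (verts F) (verts F0)"
      using \<phi> by (simp add: F0_def W_def bij_betw_def)
    then show "is_copy F F0"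
      using E0 unfolding is_copy_def by blast
    show "verts F0 \<subseteq> verts H'"
      using WV by (simp add: F0_def H'_def)
    show "bij_betw f (hyperedges F0) (hyperedges H')"
      using injf by (simp add: H'_def bij_betw_def)
    show "\<forall>x\<in>hyperedges F0. x \<subseteq> f x"
      using e by (auto simp: f_def)
  qed
  have E'_sub: "E' \<subseteq> hyperedges ?H"
    using near by (auto simp: E'_def f_def)
  have ins: "hyperedges H' = insert h E'"
    using e_in by (auto simp: H'_def E'_def f_def)
  have "card E' = card (hyperedges F0 - {e})"
    unfolding E'_def by (rule card_image) (use injf in \<open>auto intro: inj_on_subset\<close>)
  then have "card E' = card ?E - 1"
    using fin0 card0 e_in by simp
  moreover have "wf_hypergraph H'"
    unfolding wf_hypergraph_def ins
    using E'_sub h(1) \<open>finite V\<close> by (auto simp: H'_def)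
  moreover have "verts H' \<subseteq> verts ?H"
    by (simp add: H'_def)
  ultimately have "berge_through F ?H h H'"
    using E'_sub ins core unfolding berge_through_def is_berge_def by blast
  \<comment> \<open>Any Berge copy with core \<open>F0\<close> has a hyperedge containing
    \<open>e\<close>, hence one with at least \<open>u\<close> vertices outside
    \<open>S\<close>.\<close>
  moreover have "\<not> is_core F F0 H''" if "subhypergraph H'' ?H" for H''
  proof
    assume "is_core F F0 H''"
    then obtain g where "bij_betw g (hyperedges F0) (hyperedges H'')"
      "\<forall>x\<in>hyperedges F0. x \<subseteq> g x"
      unfolding is_core_def by blast
    then have ge: "g e \<in> hyperedges H''" "e \<subseteq> g e"
      using e_in by (auto simp: bij_betw_def)
    then have "g e \<in> hyperedges ?H"
      using that unfolding subhypergraph_def by blast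
    then have "g e \<subseteq> V" "card (g e - S) < u"
      by simp_all
    moreover from this have "card e \<le> card (g e - S)"
      using ge(2) e(1) \<open>finite V\<close> by (intro card_mono) (auto intro: finite_subset)
    ultimately have "card e < u"
      by simp
    with e(2) show False by simp
  qed
  ultimately show ?thesis
    using core by blast
qed

section \<open>Bounds on the oversaturation number\<close>

lemma osat_le:
  fixes H :: "nat hypergraph"
  assumes "card (verts H) = n" "berge_oversaturated r F H"
  shows "osat r n F \<le> card (hyperedges H)"
  unfolding osat_def by (rule Least_le) (use assms in blast)

theorem proposition1p1:
  fixes u r :: nat and F :: "'a hypergraph"
  assumes "u \<ge> 1" and "r > u"
    and "uniform_hypergraph u F" and "hyperedges F \<noteq> {}"
  shows "(\<lambda>n. real (osat r n F)) \<in> O(\<lambda>n. real n ^ (u - 1)) \<and>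
    (\<exists>C :: real. \<forall>n. \<exists>H :: nat hypergraph.
      uniform_hypergraph r H \<and> card (verts H) = n \<and>
      real (card (hyperedges H)) \<le> C * real n ^ (u - 1) \<and>
      (\<forall>h. h \<subseteq> verts H \<and> card h = r \<and> h \<notin> hyperedges H \<longrightarrow>
        (\<exists>H' F0. berge_through F H h H' \<and> is_core F F0 H' \<and>
          \<not> (\<exists>H''. subhypergraph H'' H \<and> is_berge F H'' \<and> is_core F F0 H''))))"
proof -
  \<comment> \<open>The size \<open>s\<close> of the fixed set is independent of \<open>n\<close>,
    so the factor \<open>2 ^ s\<close> goes into the constant \<open>C\<close>.\<close>
  define s where "s = card (verts F) + r"
  define H where "H n = near_hypergraph u r {..<s} {..<n}" for n
  define C :: real where "C = 2 ^ s * real u"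
  have unif: "uniform_hypergraph r (H n)" and card_V: "card (verts (H n)) = n" for n
    by (simp_all add: H_def uniform_near_hypergraph)
  have "card (hyperedges (H n)) \<le> 2 ^ s * u * n ^ (u - 1)" for n
    using card_near_hypergraph_le[of "{..<n}" "{..<s}" r u] \<open>r > u\<close> unfolding H_def by simp
  then have "real (card (hyperedges (H n))) \<le> real (2 ^ s * u * n ^ (u - 1))" for n
    by (rule of_nat_mono)
  then have card_E: "real (card (hyperedges (H n))) \<le> C * real n ^ (u - 1)" for n
    by (simp add: C_def)
  have core: "\<exists>H' F0. berge_through F (H n) h H' \<and> is_core F F0 H' \<and>
      \<not> (\<exists>H''. subhypergraph H'' (H n) \<and> is_berge F H'' \<and> is_core F F0 H'')"
    if h: "h \<subseteq> verts (H n) \<and> card h = r \<and> h \<notin> hyperedges (H n)" for n h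
  proof -
    have h': "h \<subseteq> {..<n}" "card (h - {..<s}) \<ge> u"
      using h by (auto simp: H_def)
    \<comment> \<open>A missing set has a vertex that is at least \<open>s\<close> and below
      \<open>n\<close>, so \<open>s < n\<close> and the fixed set lies among the vertices. For
      \<open>n\<close> at most \<open>s\<close> nothing is missing.\<close>
    then have "h - {..<s} \<noteq> {}"
      using \<open>u \<ge> 1\<close> by force
    then have "{..<s} \<subseteq> {..<n}"
      using h' by auto
    then have "\<exists>H' F0. berge_through F (H n) h H' \<and> is_core F F0 H' \<and>
        \<not> (\<exists>H''. subhypergraph H'' (H n) \<and> is_core F F0 H'')"
      unfolding H_def
      by (intro near_hypergraph_berge[OF assms(3,4)])
        (use h' h \<open>r > u\<close> in \<open>simp_all add: s_def\<close>)
    then show ?thesis by blast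
  qed
  have "berge_oversaturated r F (H n)" for n
    unfolding berge_oversaturated_def using unif core by blast
  then have osat: "real (osat r n F) \<le> C * real n ^ (u - 1)" for n
    using osat_le[OF card_V] card_E by (meson of_nat_mono order_trans)
  have "(\<lambda>n. real (osat r n F)) \<in> O(\<lambda>n. real n ^ (u - 1))"
    by (rule bigoI[where c = C], rule always_eventually) (use osat in simp)
  moreover have "\<forall>n. \<exists>H :: nat hypergraph.
      uniform_hypergraph r H \<and> card (verts H) = n \<and>
      real (card (hyperedges H)) \<le> C * real n ^ (u - 1) \<and>
      (\<forall>h. h \<subseteq> verts H \<and> card h = r \<and> h \<notin> hyperedges H \<longrightarrow>
        (\<exists>H' F0. berge_through F H h H' \<and> is_core F F0 H' \<and>
          \<not> (\<exists>H''. subhypergraph H'' H \<and> is_berge F H'' \<and> is_core F F0 H'')))"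
    (is "\<forall>n. ?P n")
  proof
    fix n
    show "?P n"
      by (rule exI[of _ "H n"], intro conjI allI impI unif card_V card_E, rule core)
  qed
  ultimately show ?thesis by blast
qed

end
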